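(* There is a $\frac{3}{2}$-competitive online algorithm with advice for multi-coloring hexagonal graphs with advice complexity $[\![\lceil \mathrm{Opt}/2\rceil]\!]$.
   Context: A hexagonal graph is a graph obtained by placing at most one node in each cell of a hexagonal grid and adding an edge between every pair of nodes in neighboring cells. Online multi-coloring: the graph is known in advance; requests arrive one at a time, each naming a node $v$, and must immediately and irrevocably receive a color (positive integer) different from every color previously assigned to $v$ or any neighbor of $v$. $A(I)$ is the number of colors used and $\mathrm{Opt}=\mathrm{Opt}(I)$ the minimum number an offline algorithm needs. Advice model: an all-powerful oracle knowing $I$ writes an infinite binary advice tape; advice complexity is the maximum index of a bit read. $A$ is $c$-competitive if there is a constant $\alpha$ with $A(I)\le c\cdot\mathrm{Opt}(I)+\alpha$ for all $I$. $[\![x]\!]$ denotes the minimum number of bits needed to encode the non-negative integer $x$ in a self-delimiting way. *)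

theory Defs
  imports Complex_Main "HOL-Library.Sublist" "Graph_Theory.Pair_Digraph"
begin

section \<open>Hexagonal graphs\<close>

text \<open>
  Cells of the hexagonal grid in axial coordinates: the pair \<open>(a, b)\<close> is the hexagon centred at
  \<open>a *\<^sub>R e + b *\<^sub>R f\<close>, where \<open>e\<close> and \<open>f\<close> have equal length and enclose an angle of 60 degrees.
\<close>

definition neighboring_cells :: "int \<times> int \<Rightarrow> int \<times> int \<Rightarrow> bool" where
  "neighboring_cells p q \<longleftrightarrow>
     (fst q - fst p, snd q - snd p) \<in> {(1, 0), (0, 1), (-1, 1), (-1, 0), (0, -1), (1, -1)}"

text \<open>An undirected edge is represented by its two arcs.\<close>

definition hexagonal_graph :: "'v pair_pre_digraph \<Rightarrow> bool" where
  "hexagonal_graph G \<longleftrightarrow>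
     (\<exists>cell. inj_on cell (pverts G) \<and>
        parcs G = {(u, v). u \<in> pverts G \<and> v \<in> pverts G \<and> neighboring_cells (cell u) (cell v)})"

section \<open>Multi-coloring\<close>

text \<open>The color \<open>cs ! i\<close> is the one assigned to the \<open>i\<close>-th request \<open>rs ! i\<close>.\<close>

definition multicoloring :: "'v pair_pre_digraph \<Rightarrow> 'v list \<Rightarrow> nat list \<Rightarrow> bool" where
  "multicoloring G rs cs \<longleftrightarrow>
     length cs = length rs \<and>
     (\<forall>c\<in>set cs. 0 < c) \<and>
     (\<forall>j<length rs. \<forall>i<j. rs ! i = rs ! j \<or> (rs ! i, rs ! j) \<in> parcs G \<longrightarrow> cs ! i \<noteq> cs ! j)"

definition Opt :: "'v pair_pre_digraph \<Rightarrow> 'v list \<Rightarrow> nat" where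
  "Opt G rs = (LEAST k. \<exists>cs. multicoloring G rs cs \<and> card (set cs) = k)"

section \<open>Online algorithms with advice\<close>

type_synonym tape = "nat \<Rightarrow> bool"

text \<open>
  A computation with access to the advice tape. The type is coinductive because a computation
  need not terminate on tapes other than those the oracle writes, e.g. while it is looking for
  the end of a self-delimiting codeword.
\<close>

codatatype 'r advised = Return 'r | Read nat "bool \<Rightarrow> 'r advised"

text \<open>
  \<open>runs \<phi> p x m\<close>: on the tape \<open>\<phi>\<close>, the computation \<open>p\<close> terminates with result \<open>x\<close>, and \<open>m\<close> is the
  maximum index of a bit it reads, where indices are counted from 1 and \<open>m = 0\<close> if none is read.
\<close>

inductive runs :: "tape \<Rightarrow> 'r advised \<Rightarrow> 'r \<Rightarrow> nat \<Rightarrow> bool" for \<phi> where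
  Return: "runs \<phi> (Return x) x 0"
| Read: "runs \<phi> (f (\<phi> i)) x m \<Longrightarrow> runs \<phi> (Read i f) x (max (Suc i) m)"

text \<open>
  The list argument consists of the requests up to and including the one to be colored now.
  Previously assigned colors and previously read advice need not be passed on, as the algorithm
  can recompute them; reading a bit again does not affect the maximum index.
\<close>

type_synonym 'v online_algorithm = "'v pair_pre_digraph \<Rightarrow> 'v list \<Rightarrow> nat advised"

type_synonym 'v advisor = "'v pair_pre_digraph \<Rightarrow> 'v list \<Rightarrow> tape"

definition online_run ::
    "'v online_algorithm \<Rightarrow> tape \<Rightarrow> 'v pair_pre_digraph \<Rightarrow> 'v list \<Rightarrow> nat list \<Rightarrow> nat \<Rightarrow> bool" where
  "online_run A \<phi> G rs cs b \<longleftrightarrow>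
     (\<exists>ms. length cs = length rs \<and> length ms = length rs \<and>
        (\<forall>i<length rs. runs \<phi> (A G (take (Suc i) rs)) (cs ! i) (ms ! i)) \<and>
        b = Max (insert 0 (set ms)))"

text \<open>
  On the graphs in \<open>\<G>\<close>, the algorithm with its oracle is \<open>c\<close>-competitive and has advice complexity
  \<open>s\<close>, as a function of the optimum. By the determinism of \<^const>\<open>runs\<close>, the colors \<open>cs\<close> and the
  maximum index \<open>b\<close> are unique.
\<close>

definition competitive_with_advice ::
    "'v pair_pre_digraph set \<Rightarrow> real \<Rightarrow> (nat \<Rightarrow> nat) \<Rightarrow> 'v online_algorithm \<Rightarrow> 'v advisor \<Rightarrow> bool" where
  "competitive_with_advice \<G> c s A orc \<longleftrightarrow>
     (\<exists>\<alpha>::real. \<forall>G\<in>\<G>. \<forall>rs. set rs \<subseteq> pverts G \<longrightarrow>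
        (\<exists>cs b. online_run A (orc G rs) G rs cs b \<and>
           multicoloring G rs cs \<and>
           real (card (set cs)) \<le> c * real (Opt G rs) + \<alpha> \<and>
           b \<le> s (Opt G rs)))"

section \<open>Self-delimiting encodings\<close>

text \<open>
  An encoding is given by its decoding function, so an integer may have several codewords.
  Self-delimiting means that the end of a codeword can be recognized without reading past it.
\<close>

definition self_delimiting :: "(bool list \<Rightarrow> nat option) \<Rightarrow> bool" where
  "self_delimiting D \<longleftrightarrow>
     (\<forall>x. \<exists>w. D w = Some x) \<and>
     (\<forall>v\<in>dom D. \<forall>w\<in>dom D. prefix v w \<longrightarrow> v = w)"

text \<open>
  The minimum number of bits needed to encode \<open>x\<close>. This depends on \<open>D\<close>: a minimum over all
  self-delimiting encodings would be 1 for every \<open>x\<close>, since each single integer has a one-bit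
  codeword in some of them.
\<close>

definition encoding_length :: "(bool list \<Rightarrow> nat option) \<Rightarrow> nat \<Rightarrow> nat" where
  "encoding_length D x = (LEAST n. \<exists>w. D w = Some x \<and> length w = n)"

end

theory Submission
  imports Defs
begin

text \<open>
  The advice is \<open>k = \<lceil>Opt/2\<rceil>\<close>. The grid is properly 3-colored, and each of the three classes owns
  a palette of \<open>k\<close> colors. A node uses the palette of its own class from the bottom up, and once this
  is exhausted, it borrows colors of the cyclically next class from the top down. Two nodes \<open>u\<close>, \<open>v\<close>
  competing for a palette are adjacent and hence have at most \<open>Opt \<le> 2k\<close> requests together, so if
  \<open>u\<close> has \<open>k + x\<close> requests, then \<open>v\<close> has at most \<open>k - x\<close>, and the two never meet.
\<close>

section \<open>Reading a self-delimiting codeword\<close>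

text \<open>The argument \<open>p\<close> holds the bits read so far, so its length is the position
  of the next bit. Reading never ends on a tape with no prefix in the domain of
  \<open>D\<close>.\<close>

primcorec read_codeword :: "(bool list \<Rightarrow> 'r option) \<Rightarrow> bool list \<Rightarrow> 'r advised" where
  "read_codeword D p =
     (case D p of Some x \<Rightarrow> Return x | None \<Rightarrow> Read (length p) (\<lambda>b. read_codeword D (p @ [b])))"

lemma runs_read_codeword:
  assumes "D w = Some x"
    and "\<And>v. prefix v w \<Longrightarrow> v \<noteq> w \<Longrightarrow> D v = None"
    and "\<And>i. i < length w \<Longrightarrow> \<phi> i = w ! i"
  shows "runs \<phi> (read_codeword D []) x (length w)"
proof -
  \<comment> \<open>Generalised to \<open>n\<close> bits already read, for an induction from
    \<open>length w\<close> down to 0. Once the codeword is complete no bit is read any more, whence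
    the 0.\<close>
  have "runs \<phi> (read_codeword D (take n w)) x (if n = length w then 0 else length w)"
    if "n \<le> length w" for n
    using that
  proof (induction rule: inc_induct)
    case base
    show ?case
      using assms(1) by (subst read_codeword.code) (simp add: runs.Return)
  next
    case (step n)
    have "take n w \<noteq> w"
      using step.hyps by (metis length_take min.absorb4 less_irrefl)
    then have "D (take n w) = None"
      using assms(2) take_is_prefix by blast
    then have unfold: "read_codeword D (take n w) =
        Read n (\<lambda>b. read_codeword D (take n w @ [b]))"
      using step.hyps by (subst read_codeword.code) simp
    have "take n w @ [\<phi> n] = take (Suc n) w"
      using step.hyps assms(3) by (simp add: take_Suc_conv_app_nth)
    then have "runs \<phi> (read_codeword D (take n w)) x
        (max (Suc n) (if Suc n = length w then 0 else length w))"
      unfolding unfold using step.IH by (intro runs.Read) simp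
    moreover have "max (Suc n) (if Suc n = length w then 0 else length w) = length w"
      using step.hyps by auto
    ultimately show ?case
      using step.hyps by simp
  qed
  from this[of 0] show ?thesis
    by (cases "w = []") auto
qed

section \<open>Lower bounds for the optimum\<close>

lemma ex_optimal_multicoloring: "\<exists>cs. multicoloring G rs cs \<and> card (set cs) = Opt G rs"
proof -
  \<comment> \<open>Giving each request its own color shows that the minimum is over a nonempty
    set.\<close>
  have "multicoloring G rs (map Suc [0..<length rs])"
    by (simp add: multicoloring_def)
  then show ?thesis
    unfolding Opt_def by - (rule LeastI_ex, blast)
qed

text \<open>Any two requests to nodes of a clique conflict, even when they name the same node, so an
  optimal coloring is injective on their positions.\<close>

lemma clique_requests_le_Opt:
  assumes "\<And>u v. u \<in> S \<Longrightarrow> v \<in> S \<Longrightarrow> u \<noteq> v \<Longrightarrow> (u, v) \<in> parcs G"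
  shows "length (filter (\<lambda>x. x \<in> S) rs) \<le> Opt G rs"
proof -
  obtain cs where cs: "multicoloring G rs cs" "card (set cs) = Opt G rs"
    using ex_optimal_multicoloring by blast
  let ?I = "{i. i < length rs \<and> rs ! i \<in> S}"
  have "cs ! i \<noteq> cs ! j" if "i \<in> ?I" "j \<in> ?I" "i < j" for i j
    using that cs(1) assms[of "rs ! i" "rs ! j"] by (auto simp: multicoloring_def)
  then have "inj_on ((!) cs) ?I"
    by (metis (no_types, lifting) inj_onI linorder_neqE_nat)
  moreover have "(!) cs ` ?I \<subseteq> set cs"
    using cs(1) by (auto simp: multicoloring_def)
  ultimately have "card ?I \<le> card (set cs)"
    by (intro card_inj_on_le) auto
  then show ?thesis
    using cs(2) by (simp add: length_filter_conv_card)
qed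

lemma count_list_le_Opt: "count_list rs v \<le> Opt G rs"
proof -
  have "count_list rs v = length (filter (\<lambda>x. x \<in> {v}) rs)"
    by (induction rs) auto
  also have "\<dots> \<le> Opt G rs"
    by (intro clique_requests_le_Opt) auto
  finally show ?thesis .
qed

lemma count_list_adjacent_le_Opt:
  assumes "u \<noteq> v" "(u, v) \<in> parcs G" "(v, u) \<in> parcs G"
  shows "count_list rs u + count_list rs v \<le> Opt G rs"
proof -
  have "count_list rs u + count_list rs v = length (filter (\<lambda>x. x \<in> {u, v}) rs)"
    using assms(1) by (induction rs) auto
  also have "\<dots> \<le> Opt G rs"
    using assms by (intro clique_requests_le_Opt) auto
  finally show ?thesis .
qed

section \<open>The coloring\<close>

text \<open>A graph carries no embedding, so one is fixed by choice; it depends on \<open>G\<close>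
  alone, which is known in advance.\<close>

definition hex_cell :: "'v pair_pre_digraph \<Rightarrow> 'v \<Rightarrow> int \<times> int" where
  "hex_cell G = (SOME cell. inj_on cell (pverts G) \<and>
     parcs G = {(u, v). u \<in> pverts G \<and> v \<in> pverts G \<and> neighboring_cells (cell u) (cell v)})"

definition hex_class :: "'v pair_pre_digraph \<Rightarrow> 'v \<Rightarrow> nat" where
  "hex_class G v = nat ((fst (hex_cell G v) - snd (hex_cell G v)) mod 3)"

lemma hex_class_less: "hex_class G v < 3"
  by (simp add: hex_class_def nat_less_iff)

lemma parcs_hex_cell:
  assumes "hexagonal_graph G"
  shows "parcs G = {(u, v). u \<in> pverts G \<and> v \<in> pverts G \<and>
    neighboring_cells (hex_cell G u) (hex_cell G v)}"
  using someI_ex[OF assms[unfolded hexagonal_graph_def]] by (simp only: hex_cell_def)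

lemma neighboring_cells_sym:
  assumes "neighboring_cells p q"
  shows "neighboring_cells q p"
proof -
  define x y where "x = fst q - fst p" and "y = snd q - snd p"
  have "(x, y) \<in> {(1, 0), (0, 1), (-1, 1), (-1, 0), (0, -1), (1, -1)}"
    using assms by (simp only: neighboring_cells_def x_def y_def)
  then have "(- x, - y) \<in> {(1, 0), (0, 1), (-1, 1), (-1, 0), (0, -1), (1, -1)}"
    by auto
  then show ?thesis
    by (simp only: neighboring_cells_def x_def y_def minus_diff_eq)
qed

lemma hexagonal_graph_parcs_sym:
  assumes "hexagonal_graph G" "(u, v) \<in> parcs G"
  shows "(v, u) \<in> parcs G"
  using assms by (auto simp: parcs_hex_cell intro: neighboring_cells_sym)

text \<open>A step to a neighboring cell changes the difference of the axial coordinates by 1 or 2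
  in absolute value, never by a multiple of 3.\<close>

lemma hex_class_neq:
  assumes "hexagonal_graph G" "(u, v) \<in> parcs G"
  shows "hex_class G u \<noteq> hex_class G v"
proof -
  obtain a b c d where cells: "hex_cell G u = (a, b)" "hex_cell G v = (c, d)"
    by (metis surj_pair)
  have "neighboring_cells (a, b) (c, d)"
    using assms cells by (auto simp: parcs_hex_cell)
  then have "(c - d) - (a - b) \<in> {1, -1, 2, -2}"
    by (auto simp: neighboring_cells_def)
  then have "\<not> 3 dvd (c - d) - (a - b)"
    by (elim insertE emptyE) simp_all
  then have "(c - d) mod 3 \<noteq> (a - b) mod 3"
    by (simp only: mod_eq_dvd_iff not_False_eq_True)
  then show ?thesis
    by (simp add: hex_class_def cells eq_nat_nat_iff)
qed

text \<open>
  The color of the \<open>i\<close>-th request, counted from 1, to a node of class \<open>t\<close>. The palette of \<open>t\<close>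
  consists of the numbers \<open>3 * j + t\<close> with \<open>1 \<le> j \<le> k\<close>.
\<close>

definition borrowing_color :: "nat \<Rightarrow> nat \<Rightarrow> nat \<Rightarrow> nat" where
  "borrowing_color k t i =
     (if i \<le> k then 3 * i + t else 3 * (2 * k + 1 - i) + (t + 1) mod 3)"

text \<open>For \<open>k < i\<close> the borrowed index \<open>2 * k + 1 - i\<close> runs from
  \<open>k\<close> down to 1. All indices thus lie between 1 and \<open>k\<close>, which leaves
  \<open>3 * k\<close> colors, all positive.\<close>

lemma borrowing_color_bounds:
  assumes "t < 3" "1 \<le> i" "i \<le> 2 * k"
  shows "borrowing_color k t i \<in> {3..<3 * k + 3}"
proof (cases "i \<le> k")
  case True
  then show ?thesis
    using assms by (simp add: borrowing_color_def)
next
  case False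
  define r where "r = (t + 1) mod 3"
  have "r < 3"
    by (simp add: r_def)
  then have "3 * (2 * k + 1 - i) + r \<in> {3..<3 * k + 3}"
    using False assms(3) unfolding atLeastLessThan_iff by linarith
  then show ?thesis
    using False by (simp only: borrowing_color_def r_def if_False)
qed

lemma palette_color_eq_iff:
  fixes a b s t :: nat
  assumes "s < 3" "t < 3"
  shows "3 * a + s = 3 * b + t \<longleftrightarrow> a = b \<and> s = t"
  using assms by arith

lemma next_class_eq: "t < 3 \<Longrightarrow> (t + 1) mod 3 = (if t = 2 then 0 else t + 1)" for t :: nat
  by simp

lemma next_class_neq: "t < 3 \<Longrightarrow> (t + 1) mod 3 \<noteq> t" for t :: nat
  unfolding next_class_eq by simp

lemma next_class_inj: "s < 3 \<Longrightarrow> t < 3 \<Longrightarrow> (s + 1) mod 3 = (t + 1) mod 3 \<longleftrightarrow> s = t" for s t :: nat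
  unfolding next_class_eq by simp

text \<open>An own and a borrowed color differ modulo 3; two of the same kind differ in their
  index.\<close>

lemma borrowing_color_same_class_neq:
  assumes "t < 3" "i < j" "j \<le> 2 * k"
  shows "borrowing_color k t i \<noteq> borrowing_color k t j"
  using assms next_class_neq[OF assms(1)]
  by (auto simp: borrowing_color_def palette_color_eq_iff simp del: One_nat_def)

text \<open>Two own colors differ modulo 3, and two borrowed ones would need
  \<open>i + j > 2 * k\<close>. An own and a borrowed color can only agree if their indices do, that
  is if \<open>i + j = 2 * k + 1\<close>.\<close>

lemma borrowing_color_distinct_class_neq:
  assumes "s < 3" "t < 3" "s \<noteq> t" "i + j \<le> 2 * k"
  shows "borrowing_color k s i \<noteq> borrowing_color k t j"
  using assms next_class_inj[OF assms(1,2)]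
  by (auto simp: borrowing_color_def palette_color_eq_iff simp del: One_nat_def)

text \<open>Here \<open>rs\<close> ends with the current request, so the count includes it and
  starts at 1.\<close>

definition request_color :: "'v pair_pre_digraph \<Rightarrow> 'v list \<Rightarrow> nat \<Rightarrow> nat" where
  "request_color G rs k = borrowing_color k (hex_class G (last rs)) (count_list rs (last rs))"

lemma last_take_Suc: "i < length xs \<Longrightarrow> last (take (Suc i) xs) = xs ! i"
  by (simp add: take_Suc_conv_app_nth)

lemma count_list_take_le: "count_list (take n xs) x \<le> count_list xs x"
  by (metis append_take_drop_id count_list_append le_add1)

lemma count_list_take_less:
  assumes "i < j" "j < length xs"
  shows "count_list (take (Suc i) xs) (xs ! j) < count_list (take (Suc j) xs) (xs ! j)"
proof -
  have "count_list (take (Suc i) xs) (xs ! j) \<le> count_list (take j xs) (xs ! j)"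
    using count_list_take_le[of "Suc i" "take j xs"] assms(1) by (simp add: min_absorb1)
  also have "\<dots> < count_list (take (Suc j) xs) (xs ! j)"
    using assms(2) by (simp add: take_Suc_conv_app_nth)
  finally show ?thesis .
qed

lemma request_color_bounds:
  assumes "Opt G rs \<le> 2 * k" "i < length rs"
  shows "request_color G (take (Suc i) rs) k \<in> {3..<3 * k + 3}"
proof -
  have "1 \<le> count_list (take (Suc i) rs) (rs ! i)"
    using assms(2) by (simp add: take_Suc_conv_app_nth)
  moreover have "count_list (take (Suc i) rs) (rs ! i) \<le> 2 * k"
    using count_list_take_le count_list_le_Opt assms(1) le_trans by metis
  ultimately show ?thesis
    unfolding request_color_def last_take_Suc[OF assms(2)]
    by (intro borrowing_color_bounds hex_class_less)
qed

lemma multicoloring_request_color: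
  assumes "hexagonal_graph G" "Opt G rs \<le> 2 * k"
  shows "multicoloring G rs (map (\<lambda>i. request_color G (take (Suc i) rs) k) [0..<length rs])"
proof -
  have "request_color G (take (Suc i) rs) k \<noteq> request_color G (take (Suc j) rs) k"
    if ij: "i < j" "j < length rs" and adj: "rs ! i = rs ! j \<or> (rs ! i, rs ! j) \<in> parcs G" for i j
    using adj
  proof
    assume "rs ! i = rs ! j"
    moreover have "count_list (take (Suc j) rs) (rs ! j) \<le> 2 * k"
      using count_list_take_le count_list_le_Opt assms(2) le_trans by metis
    ultimately show ?thesis
      using ij count_list_take_less[OF ij]
      by (simp add: request_color_def last_take_Suc hex_class_less borrowing_color_same_class_neq)
  next
    assume arc: "(rs ! i, rs ! j) \<in> parcs G"
    note neq = hex_class_neq[OF assms(1) arc]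
    \<comment> \<open>The counts are taken at different times, but the final counts bound
      both.\<close>
    have "count_list (take (Suc i) rs) (rs ! i) + count_list (take (Suc j) rs) (rs ! j)
        \<le> count_list rs (rs ! i) + count_list rs (rs ! j)"
      by (intro add_mono count_list_take_le)
    also have "\<dots> \<le> Opt G rs"
      using neq arc hexagonal_graph_parcs_sym[OF assms(1) arc]
      by (intro count_list_adjacent_le_Opt) auto
    finally show ?thesis
      using ij neq assms(2)
      by (simp add: request_color_def last_take_Suc hex_class_less
          borrowing_color_distinct_class_neq)
  qed
  then show ?thesis
    using request_color_bounds[OF assms(2)] by (fastforce simp: multicoloring_def)
qed

lemma card_request_color_le:
  assumes "Opt G rs \<le> 2 * k"
  shows "card (set (map (\<lambda>i. request_color G (take (Suc i) rs) k) [0..<length rs])) \<le> 3 * k"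
proof -
  have "set (map (\<lambda>i. request_color G (take (Suc i) rs) k) [0..<length rs]) \<subseteq> {3..<3 * k + 3}"
    using request_color_bounds[OF assms] by auto
  then show ?thesis
    by (metis card_atLeastLessThan card_mono diff_add_inverse2 finite_atLeastLessThan)
qed

section \<open>The algorithm with advice\<close>

lemma ex_shortest_codeword:
  assumes "self_delimiting D"
  shows "\<exists>w. D w = Some x \<and> length w = encoding_length D x"
  unfolding encoding_length_def
  by (rule LeastI_ex) (use assms in \<open>auto simp: self_delimiting_def\<close>)

definition half_opt :: "nat \<Rightarrow> nat" where
  "half_opt opt = nat \<lceil>real opt / 2\<rceil>"

lemma half_opt_bounds: "opt \<le> 2 * half_opt opt" "2 * half_opt opt \<le> opt + 1"
  unfolding half_opt_def by linarith+

text \<open>Composing with \<open>map_option\<close> turns the decoded number into a color without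
  changing which words are codewords.\<close>

definition borrowing_algorithm :: "(bool list \<Rightarrow> nat option) \<Rightarrow> 'v online_algorithm" where
  "borrowing_algorithm D G rs = read_codeword (map_option (request_color G rs) \<circ> D) []"

text \<open>The tape is unspecified beyond the codeword, where it is never read.\<close>

definition codeword_oracle :: "(bool list \<Rightarrow> nat option) \<Rightarrow> 'v advisor" where
  "codeword_oracle D G rs =
     (let k = half_opt (Opt G rs) in
      (!) (SOME w. D w = Some k \<and> length w = encoding_length D k))"

lemma runs_borrowing_algorithm:
  assumes "self_delimiting D"
  shows "runs (codeword_oracle D G rs) (borrowing_algorithm D G rs')
    (request_color G rs' (half_opt (Opt G rs))) (encoding_length D (half_opt (Opt G rs)))"
proof -
  define k where "k = half_opt (Opt G rs)"
  define w where "w = (SOME w. D w = Some k \<and> length w = encoding_length D k)"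
  have w: "D w = Some k" "length w = encoding_length D k"
    using someI_ex[OF ex_shortest_codeword[OF assms, of k]] by (simp_all add: w_def)
  have "D v = None" if "prefix v w" "v \<noteq> w" for v
    using assms w(1) that by (auto simp: self_delimiting_def dom_def)
  then have "runs ((!) w) (borrowing_algorithm D G rs') (request_color G rs' k) (length w)"
    unfolding borrowing_algorithm_def using w(1) by (intro runs_read_codeword) simp_all
  moreover have "codeword_oracle D G rs = (!) w"
    by (simp add: codeword_oracle_def Let_def w_def k_def)
  ultimately show ?thesis
    using w(2) by (simp add: k_def)
qed

theorem theorem9:
  fixes D :: "bool list \<Rightarrow> nat option"
  assumes "self_delimiting D"
  shows "\<exists>(A :: 'v online_algorithm) orc.
           competitive_with_advice {G. hexagonal_graph G} (3/2)
             (\<lambda>opt. encoding_length D (nat \<lceil>real opt / 2\<rceil>)) A orc"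
proof -
  \<comment> \<open>The additive 3/2 is the cost of rounding up: \<open>3 * k\<close> is at most 3/2
    times \<open>Opt G rs + 1\<close>.\<close>
  have "\<exists>cs b. online_run (borrowing_algorithm D) (codeword_oracle D G rs) G rs cs b \<and>
      multicoloring G rs cs \<and> real (card (set cs)) \<le> 3/2 * real (Opt G rs) + 3/2 \<and>
      b \<le> encoding_length D (half_opt (Opt G rs))"
    if "hexagonal_graph G" for G :: "'v pair_pre_digraph" and rs
  proof -
    define k where "k = half_opt (Opt G rs)"
    define cs where "cs = map (\<lambda>i. request_color G (take (Suc i) rs) k) [0..<length rs]"
    \<comment> \<open>Each request rereads the whole codeword, so all maximal indices
      coincide.\<close>
    define ms where "ms = replicate (length rs) (encoding_length D k)"
    have k: "Opt G rs \<le> 2 * k" "2 * k \<le> Opt G rs + 1"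
      unfolding k_def by (fact half_opt_bounds)+
    have "online_run (borrowing_algorithm D) (codeword_oracle D G rs) G rs cs
        (Max (insert 0 (set ms)))"
      unfolding online_run_def
      by (intro exI[of _ ms])
        (simp add: cs_def ms_def k_def runs_borrowing_algorithm[OF assms])
    moreover have "Max (insert 0 (set ms)) \<le> encoding_length D k"
      by (auto simp: ms_def)
    moreover have "multicoloring G rs cs"
      unfolding cs_def using that k(1) by (rule multicoloring_request_color)
    moreover have "card (set cs) \<le> 3 * k"
      unfolding cs_def using k(1) by (rule card_request_color_le)
    then have "real (card (set cs)) \<le> 3/2 * real (Opt G rs) + 3/2"
      using k(2) by linarith
    ultimately show ?thesis
      unfolding k_def by blast
  qed
  then have "competitive_with_advice {G. hexagonal_graph G} (3/2)
      (\<lambda>opt. encoding_length D (nat \<lceil>real opt / 2\<rceil>))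
      (borrowing_algorithm D :: 'v online_algorithm) (codeword_oracle D)"
    unfolding competitive_with_advice_def half_opt_def by blast
  then show ?thesis
    by blast
qed

end
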